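(* Let $n\ge1$ and let $\lambda\vdash n$ with $\lambda=1^{m_1}2^{m_2}\cdots k^{m_k}$ (i.e. $m_i$ parts equal to $i$), with parts $\lambda_1,\dots,\lambda_\ell$. Then $$\mathsf{ADerExc}_\lambda(t)=\sum_{\pi\in C_\lambda}t^{\mathsf{exc}(\pi)}=\frac{\binom{n}{\lambda_1,\dots,\lambda_\ell}}{\prod_{i=1}^k m_i!}\prod_{j=2}^k\big[tA_{j-1}(t)\big]^{m_j}.$$ If $m_1=0$, then $\mathsf{ADerExc}_\lambda(t)$ is gamma positive with center of symmetry $n/2$; if $m_1>0$, then $\mathsf{ADerExc}_\lambda(t)$ is gamma positive with center of symmetry $(n-m_1)/2$.
   Context: $\mathfrak{S}_n$ is the symmetric group on $[n]$; $C_\lambda$ is the set of $\pi\in\mathfrak{S}_n$ whose cycle type is $\lambda$. $\mathsf{exc}(\pi)=|\{i:\pi_i>i\}|$. $A_m(t)=\sum_{\sigma\in\mathfrak{S}_m}t^{\mathsf{des}(\sigma)}$ is the Eulerian polynomial, where $\mathsf{des}(\sigma)=|\{i\in[m-1]:\sigma_i>\sigma_{i+1}\}|$. $\binom{n}{\lambda_1,\dots,\lambda_\ell}$ is the multinomial coefficient. A univariate $f(t)=\sum_{i=0}^Na_it^i$ ($a_N\ne0$, $r$ least with $a_r\ne0$) is palindromic with center of symmetry $(N+r)/2$ if $a_{r+i}=a_{N-i}$ for all $i$, and gamma positive if moreover $f(t)=\sum_{i=0}^{\lfloor(N-r)/2\rfloor}\gamma_it^{r+i}(1+t)^{N-r-2i}$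 with all $\gamma_i\ge0$. *)

theory Defs
  imports
    Complex_Main
    "HOL-Library.Multiset"
    "HOL-Combinatorics.Orbits"
    "HOL-Computational_Algebra.Polynomial"
begin

definition int_partition :: "nat multiset \<Rightarrow> nat \<Rightarrow> bool" where
  "int_partition lam n \<longleftrightarrow> (\<forall>p\<in>#lam. p \<ge> 1) \<and> sum_mset lam = n"

(* Fixed points are kept: orbit \<pi> x = {x} if \<pi> x = x, contributing a part 1.  Since
   "orbit \<pi> ` {1..n}" is a set, each cycle contributes exactly one part. *)
definition cycle_type :: "nat \<Rightarrow> (nat \<Rightarrow> nat) \<Rightarrow> nat multiset" where
  "cycle_type n \<pi> = image_mset card (mset_set (orbit \<pi> ` {1..n}))"

definition cycle_class :: "nat \<Rightarrow> nat multiset \<Rightarrow> (nat \<Rightarrow> nat) set" where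
  "cycle_class n lam = {\<pi>. \<pi> permutes {1..n} \<and> cycle_type n \<pi> = lam}"

definition exc :: "nat \<Rightarrow> (nat \<Rightarrow> nat) \<Rightarrow> nat" where
  "exc n \<pi> = card {i \<in> {1..n}. \<pi> i > i}"

definition des :: "nat \<Rightarrow> (nat \<Rightarrow> nat) \<Rightarrow> nat" where
  "des m \<sigma> = card {i \<in> {1..<m}. \<sigma> i > \<sigma> (i + 1)}"

definition eulerian_poly :: "nat \<Rightarrow> real poly" where
  "eulerian_poly m = (\<Sum>\<sigma> | \<sigma> permutes {1..m}. monom 1 (des m \<sigma>))"

definition ADerExc :: "nat \<Rightarrow> nat multiset \<Rightarrow> real poly" where
  "ADerExc n lam = (\<Sum>\<pi>\<in>cycle_class n lam. monom 1 (exc n \<pi>))"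

(* A multinomial coefficient only if the parts of lam sum to n. *)
definition multinomial :: "nat \<Rightarrow> nat multiset \<Rightarrow> real" where
  "multinomial n lam = fact n / (\<Prod>p\<in>#lam. fact p)"

(* Meaningful only for f \<noteq> 0. *)
definition low_degree :: "real poly \<Rightarrow> nat" where
  "low_degree f = (LEAST r. coeff f r \<noteq> 0)"

(* The coefficients outside the range low_degree f, ..., degree f all vanish, so only
   i \<le> degree f - low_degree f needs to be considered; this also keeps the
   subtraction on nat exact. *)
definition palindromic :: "real poly \<Rightarrow> bool" where
  "palindromic f \<longleftrightarrow> f \<noteq> 0 \<and>
     (\<forall>i \<le> degree f - low_degree f. coeff f (low_degree f + i) = coeff f (degree f - i))"

definition center_of_symmetry :: "real poly \<Rightarrow> real" where
  "center_of_symmetry f = (real (degree f) + real (low_degree f)) / 2"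

definition gamma_positive :: "real poly \<Rightarrow> bool" where
  "gamma_positive f \<longleftrightarrow> palindromic f \<and>
     (let N = degree f; r = low_degree f in
      \<exists>\<gamma> :: nat \<Rightarrow> real. (\<forall>i \<le> (N - r) div 2. \<gamma> i \<ge> 0) \<and>
        f = (\<Sum>i\<le>(N - r) div 2. smult (\<gamma> i) (monom 1 (r + i) * [:1, 1:] ^ (N - r - 2 * i))))"

end

theory Submission
  imports Defs
begin

text \<open>
  Splitting off the cycle that contains a chosen element gives a recursion for
  the excedance generating function over a cycle class, whose solution is the product of the
  generating functions of single cycles, up to the size of the class. For single cycles of
  length \<open>m + 1\<close>, insertion of a new maximum yields
  \<open>Q\<^sub>m\<^sub>+\<^sub>1 = (m + 1) t Q\<^sub>m + t (1 - t) Q\<^sub>m'\<close>. Reading a cycle from its maximum identifies \<open>Q\<^sub>m\<close> with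
  \<open>t A\<^sub>m(t)\<close> for \<open>m \<ge> 1\<close>. The recursion sends each \<open>t\<^sup>i (1 + t)\<^sup>d\<^sup>-\<^sup>2\<^sup>i\<close> with \<open>d = m + 1\<close> to a nonnegative
  combination of such polynomials for \<open>d + 1\<close>, and products of these again have this shape, which
  gives gamma positivity.
\<close>

section \<open>Excedances of cyclic permutations\<close>

text \<open>\<open>exc\<close> for an arbitrary set of labels: deleting a cycle from
  \<open>{1..n}\<close> need not leave an initial segment.\<close>

definition excedances :: "nat set \<Rightarrow> (nat \<Rightarrow> nat) \<Rightarrow> nat" where
  "excedances S f = card {i \<in> S. f i > i}"

text \<open>Requiring \<open>c permutes S\<close> makes \<open>c\<close> the identity outside
  \<open>S\<close>, so that each cyclic arrangement of \<open>S\<close> is represented by exactly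
  one function.\<close>

definition cycles_on :: "'a set \<Rightarrow> ('a \<Rightarrow> 'a) set" where
  "cycles_on S = {c. c permutes S \<and> cyclic_on c S}"

section \<open>Invariant subsets and the insertion of a point into a cycle\<close>

lemma orbit_subset_invariant:
  assumes "f ` T \<subseteq> T" "x \<in> T"
  shows "orbit f x \<subseteq> T"
proof
  fix y assume "y \<in> orbit f x"
  then show "y \<in> T" by induct (use assms in auto)
qed

text \<open>Every orbit is invariant, and an invariant set contains the orbits of its points. This
  criterion replaces orbit computations when a point is inserted into or deleted from a
  cycle.\<close>

lemma cyclic_on_iff_no_invariant_subset:
  assumes "finite S" "f permutes S" "S \<noteq> {}"
  shows "cyclic_on f S \<longleftrightarrow> (\<forall>T\<subseteq>S. T \<noteq> {} \<longrightarrow> f ` T \<subseteq> T \<longrightarrow> T = S)"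
proof
  assume cyc: "cyclic_on f S"
  show "\<forall>T\<subseteq>S. T \<noteq> {} \<longrightarrow> f ` T \<subseteq> T \<longrightarrow> T = S"
  proof (intro allI impI)
    fix T assume T: "T \<subseteq> S" "T \<noteq> {}" "f ` T \<subseteq> T"
    then obtain x where "x \<in> T" by blast
    moreover from this T have "orbit f x = S" using cyc by (auto simp: orbit_cyclic_eq3)
    ultimately show "T = S" using orbit_subset_invariant[of f T x] T by blast
  qed
next
  assume inv: "\<forall>T\<subseteq>S. T \<noteq> {} \<longrightarrow> f ` T \<subseteq> T \<longrightarrow> T = S"
  obtain x where x: "x \<in> S" using assms by blast
  have "orbit f x \<subseteq> S" using assms x by (intro permutes_orbit_subset)
  moreover have "f ` orbit f x \<subseteq> orbit f x" by (auto intro: orbit.step)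
  ultimately have "orbit f x = S" using inv orbit_nonempty[of f x] by blast
  with x show "cyclic_on f S" by (auto simp: cyclic_on_def)
qed

text \<open>The map \<open>c \<circ> transpose i M\<close> inserts \<open>M\<close> into the cycle \<open>c\<close> between \<open>i\<close> and \<open>c i\<close>.\<close>

lemma cycles_on_insert_bij:
  assumes "finite S" "S \<noteq> {}" "M \<notin> S"
  shows "bij_betw (\<lambda>(c, i). c \<circ> transpose i M) (cycles_on S \<times> S) (cycles_on (insert M S))"
\<comment> \<open>\<open>inv d M\<close> is the predecessor of \<open>M\<close> in \<open>d\<close>.
  Transpositions are involutions, so composing with the same one again undoes the insertion.\<close>
proof (rule bij_betw_byWitness[where f' = "\<lambda>d. (d \<circ> transpose (inv d M) M, inv d M)"])
  show "\<forall>p\<in>cycles_on S \<times> S. (\<lambda>d. (d \<circ> transpose (inv d M) M, inv d M))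
          ((\<lambda>(c, i). c \<circ> transpose i M) p) = p"
  proof
    fix p assume "p \<in> cycles_on S \<times> S"
    then obtain c i where p: "p = (c, i)" and c: "c \<in> cycles_on S" and i: "i \<in> S" by auto
    have perm: "c permutes insert M S" using c by (auto simp: cycles_on_def intro: permutes_subset)
    have "(c \<circ> transpose i M) permutes insert M S"
      using i perm by (intro permutes_compose permutes_swap_id) auto
    moreover have "(c \<circ> transpose i M) i = M"
      using c assms by (auto simp: cycles_on_def permutes_not_in)
    ultimately have "inv (c \<circ> transpose i M) M = i" using permutes_inv_eq by metis
    then show "(\<lambda>d. (d \<circ> transpose (inv d M) M, inv d M)) ((\<lambda>(c, i). c \<circ> transpose i M) p) = p"
      unfolding p prod.case by (simp add: comp_assoc)
  qed
  show "\<forall>d\<in>cycles_on (insert M S). (\<lambda>(c, i). c \<circ> transpose i M)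
          (d \<circ> transpose (inv d M) M, inv d M) = d"
    by (auto simp: comp_assoc)
  show "(\<lambda>(c, i). c \<circ> transpose i M) ` (cycles_on S \<times> S) \<subseteq> cycles_on (insert M S)"
  proof clarify
    fix c i assume c: "c \<in> cycles_on S" and i: "i \<in> S"
    let ?d = "c \<circ> transpose i M"
    have iM: "i \<noteq> M" using i assms by auto
    have permS: "c permutes S" using c by (simp add: cycles_on_def)
    have perm: "c permutes insert M S" using permS by (auto intro: permutes_subset)
    have d: "?d permutes insert M S"
      using i perm by (intro permutes_compose permutes_swap_id) auto
    have dM: "?d M = c i" by simp
    have di: "?d i = M" using permS assms by (simp add: permutes_not_in)
    have dx: "?d x = c x" if "x \<noteq> i" "x \<noteq> M" for x using that by (simp add: transpose_def)
    have ciM: "c i \<in> S" using permS i by (simp add: permutes_in_image)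
    have "cyclic_on ?d (insert M S)"
    proof (subst cyclic_on_iff_no_invariant_subset)
      show "finite (insert M S)" "?d permutes insert M S" "insert M S \<noteq> {}" using assms d by auto
      show "\<forall>T\<subseteq>insert M S. T \<noteq> {} \<longrightarrow> ?d ` T \<subseteq> T \<longrightarrow> T = insert M S"
      proof (intro allI impI)
        fix T assume T: "T \<subseteq> insert M S" "T \<noteq> {}" "?d ` T \<subseteq> T"
        \<comment> \<open>\<open>T\<close> cannot be \<open>{M}\<close>, because \<open>M\<close> is
          sent to \<open>c i\<close>, which lies in \<open>S\<close>.\<close>
        have ne: "T - {M} \<noteq> {}"
        proof
          assume "T - {M} = {}"
          then have "M \<in> T" using T by auto
          then have "c i \<in> T" using T(3) dM by (metis image_subset_iff)
          then show False using ciM \<open>T - {M} = {}\<close> assms(3) by blast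
        qed
        \<comment> \<open>The only step of \<open>c\<close> that is missing in the extended cycle is
          the one from \<open>i\<close>; it becomes two steps, through \<open>M\<close>.\<close>
        have invT: "c ` (T - {M}) \<subseteq> T - {M}"
        proof
          fix y assume "y \<in> c ` (T - {M})"
          then obtain x where x: "x \<in> T" "x \<noteq> M" "y = c x" by auto
          then have xS: "x \<in> S" using T by auto
          then have yS: "y \<in> S" using x permS by (simp add: permutes_in_image)
          have "y \<in> T"
          proof (cases "x = i")
            case True
            then have "M \<in> T" using x(1) di T(3) by (metis image_subset_iff)
            then show ?thesis using dM T(3) x True by (metis image_subset_iff)
          next
            case False
            then show ?thesis using dx x T(3) by (metis image_subset_iff)
          qed
          then show "y \<in> T - {M}" using yS assms(3) by auto
        qed
        have "cyclic_on c S" using c by (simp add: cycles_on_def)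
        moreover have "T - {M} \<subseteq> S" using T by blast
        ultimately have "T - {M} = S"
          using cyclic_on_iff_no_invariant_subset[OF assms(1) permS assms(2)] ne invT by simp
        then have "i \<in> T" using i by blast
        then have "M \<in> T" using di T(3) by (metis image_subset_iff)
        then show "T = insert M S" using \<open>T - {M} = S\<close> by blast
      qed
    qed
    with d show "?d \<in> cycles_on (insert M S)" by (simp add: cycles_on_def)
  qed
  show "(\<lambda>d. (d \<circ> transpose (inv d M) M, inv d M)) ` cycles_on (insert M S) \<subseteq> cycles_on S \<times> S"
  proof (rule image_subsetI)
    fix d assume d: "d \<in> cycles_on (insert M S)"
    define i where "i = inv d M"
    define c where "c = d \<circ> transpose i M"
    have perm: "d permutes insert M S" using d by (simp add: cycles_on_def)
    have cyc: "T = insert M S" if "T \<subseteq> insert M S" "T \<noteq> {}" "d ` T \<subseteq> T" for T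
      using d cyclic_on_iff_no_invariant_subset[OF _ perm] that assms(1)
      by (simp add: cycles_on_def)
    have di: "d i = M" unfolding i_def using permutes_inverses(1)[OF perm] by simp
    \<comment> \<open>If \<open>M\<close> were fixed, \<open>{M}\<close> would be a proper invariant
      subset, as \<open>S\<close> is nonempty.\<close>
    have "i \<noteq> M"
    proof
      assume "i = M"
      then have "{M} = insert M S" using di by (intro cyc) auto
      then show False using assms by auto
    qed
    moreover have "i \<in> insert M S" using di permutes_in_image[OF perm, of i] by auto
    ultimately have i: "i \<in> S" by auto
    have "c permutes insert M S" unfolding c_def
      using i perm by (intro permutes_compose permutes_swap_id) auto
    moreover have cM: "c M = M" using di by (simp add: c_def)
    ultimately have permS: "c permutes S" by (auto intro: permutes_superset)
    have ci: "c i = d M" by (simp add: c_def)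
    have cx: "c x = d x" if "x \<noteq> i" "x \<noteq> M" for x using that by (simp add: c_def transpose_def)
    have "cyclic_on c S"
    proof (subst cyclic_on_iff_no_invariant_subset[OF assms(1) permS assms(2)]; intro allI impI)
      fix T assume T: "T \<subseteq> S" "T \<noteq> {}" "c ` T \<subseteq> T"
      show "T = S"
      \<comment> \<open>If \<open>T\<close> avoids \<open>i\<close>, then \<open>c\<close> and
        \<open>d\<close> agree on it and \<open>T\<close> is a \<open>d\<close>-invariant set
        missing \<open>M\<close>, which is impossible. Otherwise \<open>insert M T\<close> is
        \<open>d\<close>-invariant.\<close>
      proof (cases "i \<in> T")
        case False
        have "d ` T \<subseteq> T"
        proof (rule image_subsetI)
          fix x assume x: "x \<in> T"
          then have "d x = c x" using False cx T assms by (metis subsetD)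
          then show "d x \<in> T" using x T by auto
        qed
        then have "T = insert M S" using T by (intro cyc) auto
        then show ?thesis using T assms by auto
      next
        case True
        have "d ` insert M T \<subseteq> insert M T"
        proof (rule image_subsetI)
          fix x assume x: "x \<in> insert M T"
          consider "x = M" | "x = i" | "x \<in> T" "x \<noteq> i" "x \<noteq> M" using x by auto
          then show "d x \<in> insert M T"
          proof cases
            case 1 then show ?thesis using ci True T by (metis image_subset_iff insertCI)
          next
            case 2 then show ?thesis using di by simp
          next
            case 3 then show ?thesis using cx T by (metis image_subset_iff insertCI)
          qed
        qed
        then have "insert M T = insert M S" using T by (intro cyc) auto
        then show ?thesis using T assms by auto
      qed
    qed
    then show "(d \<circ> transpose (inv d M) M, inv d M) \<in> cycles_on S \<times> S"
      using permS i by (simp add: cycles_on_def c_def i_def)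
  qed
qed

text \<open>The arc from \<open>i\<close> to \<open>c i\<close> is replaced by two arcs,
  \<open>i\<close> to \<open>M\<close> and \<open>M\<close> to \<open>c i\<close>. As
  \<open>M\<close> exceeds all of \<open>S\<close>, \<open>i\<close> becomes an excedance and
  \<open>M\<close> is none; no other point changes.\<close>

lemma excedances_insert:
  assumes "finite S" "c permutes S" "i \<in> S" "\<And>x. x \<in> S \<Longrightarrow> x < M"
  shows "excedances (insert M S) (c \<circ> transpose i M) = 
         (if c i > i then excedances S c else Suc (excedances S c))"
proof -
  have M: "M \<notin> S" using assms(4) by auto
  have cM: "c M = M" using M assms by (simp add: permutes_not_in)
  have ciS: "c i < M" using assms by (simp add: permutes_in_image)
  have "{x \<in> insert M S. (c \<circ> transpose i M) x > x} = insert i {x \<in> S. c x > x}"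
    using assms(3,4) M cM ciS by (auto simp: transpose_def split: if_splits)
  then show ?thesis
    using assms by (auto simp: excedances_def card_insert_if)
qed

section \<open>The excedance generating function of the cycles on a finite set\<close>

lemma excedances_le_card: "finite S \<Longrightarrow> excedances S f \<le> card S"
  unfolding excedances_def by (rule card_mono) auto

text \<open>The generating function of the cycles on \<open>m + 1\<close> points. The recursion counts the insertions
  of a new maximum into a cycle: one of the \<open>m + 1\<close> arcs is subdivided, and the number of
  excedances grows by one exactly if that arc is not an excedance.\<close>

primrec cycle_exc_poly :: "nat \<Rightarrow> real poly" where
  "cycle_exc_poly 0 = 1"
| "cycle_exc_poly (Suc m) = smult (real (Suc m)) ([:0, 1:] * cycle_exc_poly m)
     + [:0, 1:] * [:1, -1:] * pderiv (cycle_exc_poly m)"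

lemma smult_sum_right: "smult c (\<Sum>i\<in>I. f i) = (\<Sum>i\<in>I. smult c (f i))"
  by (induction I rule: infinite_finite_induct) (simp_all add: smult_add_right)

lemma pderiv_sum: "pderiv (\<Sum>i\<in>I. f i) = (\<Sum>i\<in>I. pderiv (f i))"
  by (induction I rule: infinite_finite_induct) (simp_all add: pderiv_add)

text \<open>A cycle with e excedances has e insertions that keep e and s - e that raise it, where s
  is \<open>card S\<close>. The result e t^e + (s - e) t^(e+1) equals s t t^e plus t (1 - t) times
  the derivative of t^e; linearity does the rest.\<close>

lemma sum_cycles_on_insert:
  fixes S :: "nat set"
  assumes "finite S" "S \<noteq> {}" "\<And>x. x \<in> S \<Longrightarrow> x < M"
  defines "P \<equiv> (\<Sum>c\<in>cycles_on S. monom (1::real) (excedances S c))"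
  shows "(\<Sum>d\<in>cycles_on (insert M S). monom 1 (excedances (insert M S) d)) =
         smult (real (card S)) ([:0, 1:] * P) + [:0, 1:] * [:1, -1:] * pderiv P"
proof -
  have M: "M \<notin> S" using assms(3) by auto
  have "(\<Sum>d\<in>cycles_on (insert M S). monom (1::real) (excedances (insert M S) d)) =
    (\<Sum>p\<in>cycles_on S \<times> S. monom 1 (excedances (insert M S) ((\<lambda>(c, i). c \<circ> transpose i M) p)))"
    by (rule sum.reindex_bij_betw[OF cycles_on_insert_bij, symmetric]) (use assms M in auto)
  also have "\<dots> = (\<Sum>c\<in>cycles_on S. \<Sum>i\<in>S. 
       if c i > i then monom 1 (excedances S c) else monom 1 (Suc (excedances S c)))"
    unfolding sum.cartesian_product using assms
    by (intro sum.cong refl) (auto simp: cycles_on_def excedances_insert split: if_splits)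
  also have "\<dots> = (\<Sum>c\<in>cycles_on S. smult (real (card S)) ([:0, 1:] * monom 1 (excedances S c)) 
        + [:0, 1:] * [:1, -1:] * pderiv (monom 1 (excedances S c)))"
  proof (rule sum.cong[OF refl])
    fix c
    define e where "e = excedances S c"
    have "S \<inter> {i. c i > i} = {i\<in>S. c i > i}" "S \<inter> - {i. c i > i} = S - {i\<in>S. c i > i}" by auto
    then have card: "card (S \<inter> {i. c i > i}) = e" "card (S \<inter> - {i. c i > i}) = card S - e"
      using assms(1) by (simp_all add: e_def excedances_def card_Diff_subset)
    have e: "e \<le> card S" using assms by (simp add: e_def excedances_le_card)
    have "(\<Sum>i\<in>S. if c i > i then monom 1 e else monom (1::real) (Suc e)) =
        smult (real e) (monom 1 e) + smult (real (card S - e)) (monom 1 (Suc e))"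
      using assms card by (simp add: sum.If_cases of_nat_poly)
    also have "\<dots> = smult (real (card S)) ([:0, 1:] * monom 1 e) 
        + [:0, 1:] * [:1, -1:] * pderiv (monom 1 e)"
    proof -
      have X: "[:0, 1:] * monom b k = monom (b::real) (Suc k)" for b k by (simp add: monom_Suc)
      have X_pderiv: "[:0, 1:] * pderiv (monom 1 e) = monom (real e) e"
        unfolding pderiv_monom by (cases e) (simp_all add: monom_Suc)
      have "[:0, 1:] * [:1, -1:] * pderiv (monom 1 e) =
          [:0, 1:] * pderiv (monom (1::real) e) - [:0, 1:] * ([:0, 1:] * pderiv (monom 1 e))"
        by (simp add: algebra_simps)
      also have "\<dots> = monom (real e) e - monom (real e) (Suc e)" by (simp only: X_pderiv X)
      finally show ?thesis using e unfolding X
        by (simp add: smult_monom of_nat_diff diff_monom[symmetric])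
    qed
    finally show "(\<Sum>i\<in>S. if c i > i then monom 1 (excedances S c) else monom (1::real) (Suc (excedances S c)))
      = smult (real (card S)) ([:0, 1:] * monom 1 (excedances S c)) 
        + [:0, 1:] * [:1, -1:] * pderiv (monom 1 (excedances S c))"
      unfolding e_def .
  qed
  also have "\<dots> = smult (real (card S)) ([:0, 1:] * P) + [:0, 1:] * [:1, -1:] * pderiv P"
    unfolding P_def pderiv_sum by (simp only: sum.distrib sum_distrib_left smult_sum_right)
  finally show ?thesis .
qed

text \<open>Removing the maximum brings any \<open>S\<close> into the form required by
  \<open>sum_cycles_on_insert\<close>, so only the cardinality matters.\<close>

lemma sum_cycles_on_eq:
  fixes S :: "nat set"
  assumes "finite S" "card S = Suc m"
  shows "(\<Sum>c\<in>cycles_on S. monom 1 (excedances S c)) = cycle_exc_poly m"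
  using assms
proof (induction m arbitrary: S)
  case 0
  then obtain a where S: "S = {a}" by (auto simp: card_Suc_eq)
  have "cyclic_on id {a}" using orbit_eq_singleton_iff[of id a] by (simp add: cyclic_on_def)
  then have "cycles_on {a} = {id}" by (auto simp: cycles_on_def)
  then show ?case by (simp add: S excedances_def monom_0)
next
  case (Suc m)
  define M where "M = Max S"
  have ne: "S \<noteq> {}" using Suc.prems by auto
  then have M: "M \<in> S" using Suc.prems by (simp add: M_def)
  have card: "card (S - {M}) = Suc m" using Suc.prems M by simp
  have lt: "x < M" if "x \<in> S - {M}" for x
    using that Suc.prems Max_ge[of S x] by (auto simp: M_def order_less_le)
  have "insert M (S - {M}) = S" using M by auto
  moreover have "S - {M} \<noteq> {}" using card by (metis card.empty nat.distinct(1))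
  ultimately show ?case
    using sum_cycles_on_insert[of "S - {M}" M] lt card Suc.IH[of "S - {M}"] Suc.prems by simp
qed

text \<open>The factor 1 - t kills the derivative term at t = 1, which leaves the recursion of the
  factorial.\<close>

lemma poly_cycle_exc_poly_1: "poly (cycle_exc_poly m) 1 = fact m"
  by (induction m) auto

lemma card_cycles_on:
  fixes S :: "nat set"
  assumes "finite S" "card S = Suc m"
  shows "card (cycles_on S) = fact m"
proof -
  have "real (card (cycles_on S)) = poly (\<Sum>c\<in>cycles_on S. monom 1 (excedances S c)) 1"
    by (simp add: poly_sum poly_monom)
  also have "\<dots> = real (fact m)" using assms by (simp add: sum_cycles_on_eq poly_cycle_exc_poly_1)
  finally show ?thesis by linarith
qed

section \<open>Cycles and Eulerian polynomials\<close>

text \<open>\<open>funpow_dist1 c a a\<close> is the first return time of \<open>a\<close>; the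
  powers below it are distinct and sweep the whole orbit, so it equals
  \<open>card S\<close>.\<close>

lemma cycles_on_funpow:
  assumes "c \<in> cycles_on S" "finite S" "a \<in> S"
  shows "bij_betw (\<lambda>i. (c ^^ i) a) {0..<card S} S" "(c ^^ card S) a = a"
proof -
  have orb: "orbit c a = S" using assms by (simp add: cycles_on_def orbit_cyclic_eq3)
  then have a: "a \<in> orbit c a" using assms by simp
  have img: "(\<lambda>i. (c ^^ i) a) ` {0..<funpow_dist1 c a a} = S"
    using orbit_conv_funpow_dist1[OF a] orb by simp
  have inj: "inj_on (\<lambda>i. (c ^^ i) a) {0..<funpow_dist1 c a a}" by (rule inj_on_funpow_dist1[OF a])
  have eq: "card S = funpow_dist1 c a a" using card_image[OF inj] img by simp
  show "bij_betw (\<lambda>i. (c ^^ i) a) {0..<card S} S"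
    unfolding eq bij_betw_def using inj img by blast
  show "(c ^^ card S) a = a" unfolding eq by (rule funpow_dist1_prop[OF a])
qed

text \<open>Reads a cycle as a word starting after its maximum. Complementing the letters turns the ascents,
  which are the excedances of the cycle, into descents.\<close>

definition cycle_word :: "nat \<Rightarrow> (nat \<Rightarrow> nat) \<Rightarrow> nat \<Rightarrow> nat" where
  "cycle_word m c i = (if i \<in> {1..m} then Suc m - (c ^^ i) (Suc m) else i)"

lemma cycles_on_orbit_Max:
  assumes "c \<in> cycles_on {1..Suc m}"
  shows "bij_betw (\<lambda>i. (c ^^ i) (Suc m)) {0..m} {1..Suc m}"
    and "bij_betw (\<lambda>i. (c ^^ i) (Suc m)) {1..m} {1..m}"
    and "(c ^^ Suc m) (Suc m) = Suc m"
proof -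
  note * = cycles_on_funpow[OF assms, of "Suc m"]
  show 1: "bij_betw (\<lambda>i. (c ^^ i) (Suc m)) {0..m} {1..Suc m}"
    using *(1) by (simp add: atLeastLessThanSuc_atLeastAtMost)
  \<comment> \<open>Position 0 carries the letter \<open>Suc m\<close>; dropping both leaves a word
    on the letters \<open>{1..m}\<close>.\<close>
  have "bij_betw (\<lambda>i. (c ^^ i) (Suc m)) ({0..m} - {0}) ({1..Suc m} - {(c ^^ 0) (Suc m)})"
    by (rule bij_betw_DiffI[OF 1]) auto
  moreover have "{0..m} - {0} = {1..m}" "{1..Suc m} - {Suc m} = {1..m}" by auto
  ultimately show "bij_betw (\<lambda>i. (c ^^ i) (Suc m)) {1..m} {1..m}" by simp
  show "(c ^^ Suc m) (Suc m) = Suc m" using *(2) by simp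
qed

lemma cycle_word_permutes:
  assumes "c \<in> cycles_on {1..Suc m}"
  shows "cycle_word m c permutes {1..m}"
proof (rule bij_imp_permutes)
  have "bij_betw (\<lambda>x. Suc m - x) {1..m} {1..m}"
    by (rule bij_betw_byWitness[where f' = "\<lambda>x. Suc m - x"]) auto
  then have "bij_betw ((\<lambda>x. Suc m - x) \<circ> (\<lambda>i. (c ^^ i) (Suc m))) {1..m} {1..m}"
    using cycles_on_orbit_Max(2)[OF assms] by (rule bij_betw_trans[rotated])
  then show "bij_betw (cycle_word m c) {1..m} {1..m}"
    by (subst bij_betw_cong[where g = "(\<lambda>x. Suc m - x) \<circ> (\<lambda>i. (c ^^ i) (Suc m))"])
      (auto simp: cycle_word_def)
qed (auto simp: cycle_word_def)

lemma inj_on_cycle_word: "inj_on (cycle_word m) (cycles_on {1..Suc m})"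
proof (rule inj_onI)
  fix c d assume c: "c \<in> cycles_on {1..Suc m}" and d: "d \<in> cycles_on {1..Suc m}"
    and eq: "cycle_word m c = cycle_word m d"
  \<comment> \<open>The range includes \<open>Suc m\<close> because the image of the letter in
    position \<open>m\<close> is read off in the next position.\<close>
  have *: "(c ^^ i) (Suc m) = (d ^^ i) (Suc m)" if "i \<le> Suc m" for i
  proof -
    have "i = 0 \<or> i = Suc m \<or> i \<in> {1..m}" using that by auto
    then consider "i = 0" | "i = Suc m" | "i \<in> {1..m}" by blast
    then show ?thesis
    proof cases
      case 3
      have "Suc m - (c ^^ i) (Suc m) = Suc m - (d ^^ i) (Suc m)"
        using fun_cong[OF eq, of i] 3 by (simp add: cycle_word_def)
      \<comment> \<open>Both letters are at most \<open>m\<close>, so the truncated subtraction from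
        \<open>Suc m\<close> can be cancelled.\<close>
      moreover have "(c ^^ i) (Suc m) \<in> {1..m}" "(d ^^ i) (Suc m) \<in> {1..m}"
        using bij_betw_apply[OF cycles_on_orbit_Max(2)[OF c] 3]
          bij_betw_apply[OF cycles_on_orbit_Max(2)[OF d] 3] by auto
      ultimately show ?thesis by auto
    qed (use cycles_on_orbit_Max(3)[OF c] cycles_on_orbit_Max(3)[OF d] in auto)
  qed
  show "c = d"
  proof
    fix x show "c x = d x"
    proof (cases "x \<in> {1..Suc m}")
      case True
      then have "x \<in> (\<lambda>i. (c ^^ i) (Suc m)) ` {0..m}"
        using bij_betw_imp_surj_on[OF cycles_on_orbit_Max(1)[OF c]] by simp
      then obtain i where i: "i \<le> m" "x = (c ^^ i) (Suc m)" by auto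
      then have "c x = (c ^^ Suc i) (Suc m)" by simp
      also have "\<dots> = (d ^^ Suc i) (Suc m)" using i by (intro *) auto
      also have "\<dots> = d x" using i * by simp
      finally show ?thesis .
    next
      case False
      then show ?thesis
        using c d permutes_not_in[of c "{1..Suc m}" x] permutes_not_in[of d "{1..Suc m}" x]
        unfolding cycles_on_def by simp
    qed
  qed
qed

text \<open>Position 0 holds the maximum and is never an excedance; position \<open>m\<close> is
  followed by the maximum and always is one. The positions between contribute the ascents, which
  complementation turns into descents. \<open>m \<ge> 1\<close> keeps positions 0 and
  \<open>m\<close> apart.\<close>

lemma excedances_eq_Suc_des:
  assumes "c \<in> cycles_on {1..Suc m}" "m \<ge> 1"
  shows "excedances {1..Suc m} c = Suc (des m (cycle_word m c))"
proof -
  let ?f = "\<lambda>i. (c ^^ i) (Suc m)"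
  note * = cycles_on_orbit_Max[OF assms(1)]
  have le: "?f i \<in> {1..m}" if "i \<in> {1..m}" for i using bij_betw_apply[OF *(2) that] .
  have bnd: "c (Suc m) \<le> Suc m" using le[of 1] assms(2) by auto
  have "bij_betw ?f {i \<in> {0..m}. ?f i < c (?f i)} {x \<in> {1..Suc m}. x < c x}"
  proof -
    have "{x \<in> {1..Suc m}. x < c x} = ?f ` {i \<in> {0..m}. ?f i < c (?f i)}"
      unfolding bij_betw_imp_surj_on[OF *(1), symmetric] by blast
    moreover have "inj_on ?f {i \<in> {0..m}. ?f i < c (?f i)}"
      using bij_betw_imp_inj_on[OF *(1)] by (rule inj_on_subset) blast
    ultimately show ?thesis by (simp add: bij_betw_def)
  qed
  then have "excedances {1..Suc m} c = card {i \<in> {0..m}. ?f i < c (?f i)}"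
    by (simp add: excedances_def bij_betw_same_card)
  also have "{i \<in> {0..m}. ?f i < c (?f i)} = insert m {i \<in> {1..<m}. ?f i < ?f (Suc i)}"
  proof (intro equalityI subsetI)
    fix i assume i: "i \<in> {i \<in> {0..m}. ?f i < c (?f i)}"
    then have "i \<noteq> 0" using bnd by (metis (mono_tags, lifting) funpow_0 leD mem_Collect_eq)
    with i show "i \<in> insert m {i \<in> {1..<m}. ?f i < ?f (Suc i)}" by auto
  next
    fix i assume "i \<in> insert m {i \<in> {1..<m}. ?f i < ?f (Suc i)}"
    then show "i \<in> {i \<in> {0..m}. ?f i < c (?f i)}"
      using le[of m] assms(2) *(3) by auto
  qed
  also have "card \<dots> = Suc (card {i \<in> {1..<m}. ?f i < ?f (Suc i)})" by simp
  also have "{i \<in> {1..<m}. ?f i < ?f (Suc i)} = 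
      {i \<in> {1..<m}. cycle_word m c i > cycle_word m c (i + 1)}"
  proof (rule Collect_cong, rule conj_cong[OF refl])
    fix i assume i: "i \<in> {1..<m}"
    then have "?f i \<in> {1..m}" "?f (Suc i) \<in> {1..m}" by (intro le; simp)+
    then show "?f i < ?f (Suc i) \<longleftrightarrow> cycle_word m c i > cycle_word m c (i + 1)"
      using i by (auto simp: cycle_word_def simp del: funpow.simps)
  qed
  finally show ?thesis by (simp add: des_def)
qed

text \<open>The factor t accounts for the arc returning to the maximum, an excedance that the word
  does not show.\<close>

lemma X_times_eulerian_poly:
  assumes "m \<ge> 1"
  shows "monom 1 1 * eulerian_poly m = cycle_exc_poly m"
proof -
  \<comment> \<open>Surjectivity follows by counting, as both sides have \<open>fact m\<close> elements.\<close>
  have "bij_betw (cycle_word m) (cycles_on {1..Suc m}) {\<sigma>. \<sigma> permutes {1..m}}"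
    unfolding bij_betw_def
  proof
    show "cycle_word m ` cycles_on {1..Suc m} = {\<sigma>. \<sigma> permutes {1..m}}"
    proof (rule card_subset_eq)
      show "cycle_word m ` cycles_on {1..Suc m} \<subseteq> {\<sigma>. \<sigma> permutes {1..m}}"
        using cycle_word_permutes by auto
      show "card (cycle_word m ` cycles_on {1..Suc m}) = card {\<sigma>. \<sigma> permutes {1..m}}"
        by (simp only: card_image[OF inj_on_cycle_word])
          (simp add: card_cycles_on card_permutations[OF _ finite_atLeastAtMost, of 1 m m, simplified])
    qed (simp add: finite_permutations)
  qed (rule inj_on_cycle_word)
  then have "eulerian_poly m = (\<Sum>c\<in>cycles_on {1..Suc m}. monom 1 (des m (cycle_word m c)))"
    unfolding eulerian_poly_def by (rule sum.reindex_bij_betw[symmetric])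
  then have "monom 1 1 * eulerian_poly m = 
      (\<Sum>c\<in>cycles_on {1..Suc m}. monom 1 (Suc (des m (cycle_word m c))))"
    by (simp add: sum_distrib_left mult_monom)
  also have "\<dots> = (\<Sum>c\<in>cycles_on {1..Suc m}. monom 1 (excedances {1..Suc m} c))"
    by (intro sum.cong refl) (simp only: excedances_eq_Suc_des[OF _ assms])
  also have "\<dots> = cycle_exc_poly m" by (rule sum_cycles_on_eq) auto
  finally show ?thesis .
qed

section \<open>Splitting off a cycle\<close>

definition cycle_type_on :: "nat set \<Rightarrow> (nat \<Rightarrow> nat) \<Rightarrow> nat multiset" where
  "cycle_type_on S \<pi> = image_mset card (mset_set (orbit \<pi> ` S))"

definition cycle_class_on :: "nat set \<Rightarrow> nat multiset \<Rightarrow> (nat \<Rightarrow> nat) set" where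
  "cycle_class_on S lam = {\<pi>. \<pi> permutes S \<and> cycle_type_on S \<pi> = lam}"

lemma finite_cycle_class_on: "finite S \<Longrightarrow> finite (cycle_class_on S lam)"
  unfolding cycle_class_on_def by (rule finite_subset[OF _ finite_permutations[of S]]) auto

section \<open>Composition of a cycle with a permutation of the complement\<close>

context
  fixes S C :: "nat set" and c \<rho> :: "nat \<Rightarrow> nat"
  assumes fin: "finite S" and CS: "C \<subseteq> S"
    and c: "c \<in> cycles_on C" and \<rho>: "\<rho> permutes (S - C)"
begin

lemma comp_cycle_apply_in: "x \<in> C \<Longrightarrow> (c \<circ> \<rho>) x = c x"
  using \<rho> by (simp add: permutes_not_in)

lemma comp_cycle_apply_notin: 
  assumes "x \<notin> C" shows "(c \<circ> \<rho>) x = \<rho> x"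
proof -
  have "\<rho> x \<notin> C"
    using assms permutes_in_image[OF \<rho>, of x] permutes_not_in[OF \<rho>, of x] by (cases "x \<in> S") auto
  then show ?thesis using c permutes_not_in[of c C "\<rho> x"] by (simp add: cycles_on_def)
qed

lemma comp_cycle_permutes: "(c \<circ> \<rho>) permutes S"
proof (rule permutes_compose)
  show "\<rho> permutes S" using \<rho> by (rule permutes_subset) blast
  show "c permutes S" using c CS unfolding cycles_on_def by (blast intro: permutes_subset)
qed

lemma orbit_comp_cycle_in:
  assumes "x \<in> C" shows "orbit (c \<circ> \<rho>) x = C"
proof -
  have "orbit c x = orbit (c \<circ> \<rho>) x"
    using c by (intro orbit_cong0[OF assms]) (auto simp: cycles_on_def permutes_in_image comp_cycle_apply_in simp del: comp_apply)
  moreover have "orbit c x = C" using assms c by (simp add: cycles_on_def orbit_cyclic_eq3)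
  ultimately show ?thesis by simp
qed

lemma orbit_comp_cycle_notin:
  assumes "x \<in> S - C" shows "orbit (c \<circ> \<rho>) x = orbit \<rho> x"
proof -
  have "\<rho> \<in> S - C \<rightarrow> S - C" using permutes_in_image[OF \<rho>] by blast
  then have "orbit \<rho> x = orbit (c \<circ> \<rho>) x"
    by (intro orbit_cong0[OF assms]) (simp_all add: comp_cycle_apply_notin del: comp_apply)
  then show ?thesis ..
qed

lemma cycle_type_on_comp_cycle:
  assumes "C \<noteq> {}"
  shows "cycle_type_on S (c \<circ> \<rho>) = add_mset (card C) (cycle_type_on (S - C) \<rho>)"
proof -
  have "orbit (c \<circ> \<rho>) ` S = orbit (c \<circ> \<rho>) ` C \<union> orbit (c \<circ> \<rho>) ` (S - C)"
    using CS by blast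
  also have "orbit (c \<circ> \<rho>) ` C = {C}" using orbit_comp_cycle_in assms by auto
  also have "orbit (c \<circ> \<rho>) ` (S - C) = orbit \<rho> ` (S - C)"
    using orbit_comp_cycle_notin by auto
  also have "{C} \<union> orbit \<rho> ` (S - C) = insert C (orbit \<rho> ` (S - C))" by simp
  finally have "orbit (c \<circ> \<rho>) ` S = insert C (orbit \<rho> ` (S - C))" .
  \<comment> \<open>The cycle type is built from a set of orbits, so \<open>C\<close> adds a new
    part only if it is not already an orbit of \<open>\<rho>\<close>.\<close>
  moreover have "C \<notin> orbit \<rho> ` (S - C)"
  proof
    assume "C \<in> orbit \<rho> ` (S - C)"
    then obtain x where "x \<in> S - C" "C = orbit \<rho> x" by blast
    then have "C \<subseteq> S - C" using permutes_orbit_subset[OF \<rho>] by blast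
    then show False using assms by blast
  qed
  ultimately show ?thesis using fin by (simp add: cycle_type_on_def)
qed

lemma excedances_comp_cycle:
  "excedances S (c \<circ> \<rho>) = excedances C c + excedances (S - C) \<rho>"
proof -
  have "(c \<circ> \<rho>) i = (if i \<in> C then c i else \<rho> i)" for i
    using comp_cycle_apply_in comp_cycle_apply_notin by (cases "i \<in> C") simp_all
  then have "{i \<in> S. (c \<circ> \<rho>) i > i} = {i \<in> C. c i > i} \<union> {i \<in> S - C. \<rho> i > i}"
    using CS by (auto split: if_splits)
  then show ?thesis
    unfolding excedances_def using fin CS 
    by (simp add: finite_subset card_Un_disjoint disjoint_iff)
qed

lemma perm_restrict_comp_cycle:
  "perm_restrict (c \<circ> \<rho>) C = c" "perm_restrict (c \<circ> \<rho>) (S - C) = \<rho>"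
proof -
  show "perm_restrict (c \<circ> \<rho>) C = c"
  proof
    fix x show "perm_restrict (c \<circ> \<rho>) C x = c x"
      using c comp_cycle_apply_in[of x] 
      by (cases "x \<in> C") (auto simp: perm_restrict_simps cycles_on_def permutes_not_in)
  qed
  show "perm_restrict (c \<circ> \<rho>) (S - C) = \<rho>"
  proof
    fix x show "perm_restrict (c \<circ> \<rho>) (S - C) x = \<rho> x"
      using permutes_not_in[OF \<rho>, of x] comp_cycle_apply_notin[of x] 
      by (cases "x \<in> S - C") (auto simp: perm_restrict_simps)
  qed
qed

end

text \<open>Converse of the composition above: the orbit of \<open>a\<close> and its complement are
  both invariant, so the restrictions to them are the two factors.\<close>

lemma orbit_decomposition:
  assumes "finite S" "\<pi> permutes S" "a \<in> S"
  defines "C \<equiv> orbit \<pi> a"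
  shows "perm_restrict \<pi> C \<in> cycles_on C" "perm_restrict \<pi> (S - C) permutes (S - C)"
    "perm_restrict \<pi> C \<circ> perm_restrict \<pi> (S - C) = \<pi>" "a \<in> C" "C \<subseteq> S"
proof -
  have cyc: "cyclic_on \<pi> C" unfolding C_def using assms by (intro cyclic_on_orbit)
  show CS: "C \<subseteq> S" unfolding C_def using assms by (intro permutes_orbit_subset)
  show "a \<in> C" unfolding C_def
    using assms by (intro permutation_self_in_orbit permutes_imp_permutation)
  show R: "perm_restrict \<pi> (S - C) permutes (S - C)"
    using assms(2) cyc by (rule perm_restrict_diff_cyclic)
  have "perm_restrict \<pi> C permutes C"
  proof (rule bij_imp_permutes)
    have "finite C" using CS assms(1) by (rule finite_subset)
    moreover have "\<pi> ` C \<subseteq> C" using cyclic_on_inI[OF cyc] by blast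
    moreover have "inj_on \<pi> C" using permutes_inj[OF assms(2)] by (rule inj_on_subset) simp
    ultimately have "bij_betw \<pi> C C" by (simp add: bij_betw_def endo_inj_surj)
    then show "bij_betw (perm_restrict \<pi> C) C C"
      by (subst bij_betw_cong[where g = \<pi>]) (simp_all add: perm_restrict_simps)
  qed (simp add: perm_restrict_simps)
  then show "perm_restrict \<pi> C \<in> cycles_on C" "perm_restrict \<pi> C \<circ> perm_restrict \<pi> (S - C) = \<pi>"
    using cyc R assms(2) CS perm_restrict_union[of \<pi> C "S - C"]
    by (simp_all add: cycles_on_def cyclic_on_perm_restrict Un_absorb1)
qed

text \<open>Composition and restriction to \<open>C\<close> and \<open>S - C\<close> are mutually
  inverse. \<open>card C \<in># lam\<close> ensures that the multiset difference really removes a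
  part.\<close>

lemma cycle_class_on_orbit_bij:
  assumes "finite S" "a \<in> C" "C \<subseteq> S" "card C \<in># lam"
  shows "bij_betw (\<lambda>(c, \<rho>). c \<circ> \<rho>)
    (cycles_on C \<times> cycle_class_on (S - C) (lam - {#card C#}))
    {\<pi> \<in> cycle_class_on S lam. orbit \<pi> a = C}"
proof (rule bij_betw_byWitness[where f' = "\<lambda>\<pi>. (perm_restrict \<pi> C, perm_restrict \<pi> (S - C))"])
  show "\<forall>p\<in>cycles_on C \<times> cycle_class_on (S - C) (lam - {#card C#}).
      (\<lambda>\<pi>. (perm_restrict \<pi> C, perm_restrict \<pi> (S - C))) ((\<lambda>(c, \<rho>). c \<circ> \<rho>) p) = p"
    using perm_restrict_comp_cycle[OF assms(1,3)] by (auto simp: cycle_class_on_def)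
  show "\<forall>\<pi>\<in>{\<pi> \<in> cycle_class_on S lam. orbit \<pi> a = C}.
      (\<lambda>(c, \<rho>). c \<circ> \<rho>) (perm_restrict \<pi> C, perm_restrict \<pi> (S - C)) = \<pi>"
    using orbit_decomposition(3)[OF assms(1)] assms by (auto simp: cycle_class_on_def)
  show "(\<lambda>(c, \<rho>). c \<circ> \<rho>) ` (cycles_on C \<times> cycle_class_on (S - C) (lam - {#card C#}))
      \<subseteq> {\<pi> \<in> cycle_class_on S lam. orbit \<pi> a = C}"
  proof (rule image_subsetI)
    fix p assume "p \<in> cycles_on C \<times> cycle_class_on (S - C) (lam - {#card C#})"
    then obtain c \<rho> where p: "p = (c, \<rho>)" and c: "c \<in> cycles_on C"
      and \<rho>: "\<rho> permutes (S - C)" "cycle_type_on (S - C) \<rho> = lam - {#card C#}"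
      by (auto simp: cycle_class_on_def)
    note * = assms(1,3) c \<rho>(1)
    have "C \<noteq> {}" using assms by blast
    then have "cycle_type_on S (c \<circ> \<rho>) = lam"
      using cycle_type_on_comp_cycle[OF *] \<rho>(2) assms(4) by simp
    then show "(\<lambda>(c, \<rho>). c \<circ> \<rho>) p \<in> {\<pi> \<in> cycle_class_on S lam. orbit \<pi> a = C}"
      using comp_cycle_permutes[OF *] orbit_comp_cycle_in[OF * assms(2)]
      by (simp add: p cycle_class_on_def)
  qed
  show "(\<lambda>\<pi>. (perm_restrict \<pi> C, perm_restrict \<pi> (S - C))) ` {\<pi> \<in> cycle_class_on S lam. orbit \<pi> a = C}
      \<subseteq> cycles_on C \<times> cycle_class_on (S - C) (lam - {#card C#})"
  proof (rule image_subsetI)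
    fix \<pi> assume "\<pi> \<in> {\<pi> \<in> cycle_class_on S lam. orbit \<pi> a = C}"
    then have \<pi>: "\<pi> permutes S" "cycle_type_on S \<pi> = lam" and C: "orbit \<pi> a = C"
      by (auto simp: cycle_class_on_def)
    have "a \<in> S" using assms by blast
    note dec = orbit_decomposition[OF assms(1) \<pi>(1) this, unfolded C]
    have "C \<noteq> {}" using assms by blast
    then have "lam = add_mset (card C) (cycle_type_on (S - C) (perm_restrict \<pi> (S - C)))"
      using cycle_type_on_comp_cycle[OF assms(1) dec(5,1,2)] dec(3) \<pi>(2) by simp
    then show "(perm_restrict \<pi> C, perm_restrict \<pi> (S - C)) \<in> 
        cycles_on C \<times> cycle_class_on (S - C) (lam - {#card C#})"
      using dec by (simp add: cycle_class_on_def)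
  qed
qed

lemma card_orbit_in_cycle_type_on:
  assumes "finite S" "a \<in> S"
  shows "card (orbit \<pi> a) \<in># cycle_type_on S \<pi>"
  using assms by (auto simp: cycle_type_on_def)

text \<open>Permutations are grouped by the cycle \<open>C\<close> through \<open>a\<close>.
  Excedances add up over \<open>C\<close> and \<open>S - C\<close>, so the sum over each group
  factors.\<close>

lemma sum_cycle_class_on_step:
  assumes "finite S" "a \<in> S"
  shows "(\<Sum>\<pi>\<in>cycle_class_on S lam. monom 1 (excedances S \<pi>)) =
    (\<Sum>C | a \<in> C \<and> C \<subseteq> S \<and> card C \<in># lam. cycle_exc_poly (card C - 1) *
       (\<Sum>\<rho>\<in>cycle_class_on (S - C) (lam - {#card C#}). monom 1 (excedances (S - C) \<rho>)))"
proof -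
  define T where "T = {C. a \<in> C \<and> C \<subseteq> S \<and> card C \<in># lam}"
  have finT: "finite T" unfolding T_def by (rule finite_subset[of _ "Pow S"]) (use assms in auto)
  have orbT: "(\<lambda>\<pi>. orbit \<pi> a) ` cycle_class_on S lam \<subseteq> T"
    using orbit_decomposition(4,5)[OF assms(1) _ assms(2)] card_orbit_in_cycle_type_on[OF assms]
    unfolding T_def cycle_class_on_def by auto
  have "(\<Sum>\<pi>\<in>cycle_class_on S lam. monom (1::real) (excedances S \<pi>)) =
      (\<Sum>C\<in>T. \<Sum>\<pi> | \<pi> \<in> cycle_class_on S lam \<and> orbit \<pi> a = C. monom 1 (excedances S \<pi>))"
    by (rule sum.group[OF finite_cycle_class_on[OF assms(1)] finT orbT, symmetric])
  also have "\<dots> = (\<Sum>C\<in>T. cycle_exc_poly (card C - 1) *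
       (\<Sum>\<rho>\<in>cycle_class_on (S - C) (lam - {#card C#}). monom 1 (excedances (S - C) \<rho>)))"
  proof (rule sum.cong[OF refl])
    fix C assume "C \<in> T"
    then have C: "a \<in> C" "C \<subseteq> S" "card C \<in># lam" by (auto simp: T_def)
    have finC: "finite C" using C(2) assms(1) by (rule finite_subset)
    then have "card C \<noteq> 0" using C by auto
    then have "card C = Suc (card C - 1)" by linarith
    then have cyc: "(\<Sum>c\<in>cycles_on C. monom 1 (excedances C c)) = cycle_exc_poly (card C - 1)"
      using finC by (intro sum_cycles_on_eq)
    let ?R = "cycle_class_on (S - C) (lam - {#card C#})"
    have "(\<Sum>\<pi> | \<pi> \<in> cycle_class_on S lam \<and> orbit \<pi> a = C. monom (1::real) (excedances S \<pi>)) =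
        (\<Sum>(c, \<rho>)\<in>cycles_on C \<times> ?R. monom 1 (excedances S (c \<circ> \<rho>)))"
      using sum.reindex_bij_betw[OF cycle_class_on_orbit_bij[OF assms(1) C], 
          of "\<lambda>\<pi>. monom (1::real) (excedances S \<pi>)", symmetric]
      by (simp add: case_prod_unfold)
    also have "\<dots> = (\<Sum>(c, \<rho>)\<in>cycles_on C \<times> ?R. 
        monom 1 (excedances C c) * monom 1 (excedances (S - C) \<rho>))"
      using excedances_comp_cycle[OF assms(1) C(2)]
      by (intro sum.cong refl) (auto simp: cycle_class_on_def mult_monom)
    also have "\<dots> = (\<Sum>c\<in>cycles_on C. monom 1 (excedances C c)) * (\<Sum>\<rho>\<in>?R. monom 1 (excedances (S - C) \<rho>))"
      by (simp add: sum_product sum.cartesian_product)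
    finally show "(\<Sum>\<pi> | \<pi> \<in> cycle_class_on S lam \<and> orbit \<pi> a = C. monom 1 (excedances S \<pi>)) =
        cycle_exc_poly (card C - 1) * (\<Sum>\<rho>\<in>?R. monom 1 (excedances (S - C) \<rho>))"
      unfolding cyc .
  qed
  finally show ?thesis by (simp add: T_def)
qed

lemma card_subsets_containing:
  assumes "finite S" "a \<in> S" "p \<ge> 1"
  shows "card {C. a \<in> C \<and> C \<subseteq> S \<and> card C = p} = (card S - 1) choose (p - 1)"
proof -
  have "bij_betw (insert a) {B. B \<subseteq> S - {a} \<and> card B = p - 1} {C. a \<in> C \<and> C \<subseteq> S \<and> card C = p}"
  proof (rule bij_betw_byWitness[where f' = "\<lambda>C. C - {a}"])
    show "insert a ` {B. B \<subseteq> S - {a} \<and> card B = p - 1} \<subseteq> {C. a \<in> C \<and> C \<subseteq> S \<and> card C = p}"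
    proof (rule image_subsetI)
      fix B assume "B \<in> {B. B \<subseteq> S - {a} \<and> card B = p - 1}"
      then have B: "B \<subseteq> S" "a \<notin> B" "card B = p - 1" by auto
      then have "finite B" using assms(1) by (auto intro: finite_subset)
      with B show "insert a B \<in> {C. a \<in> C \<and> C \<subseteq> S \<and> card C = p}" using assms by auto
    qed
  qed (use assms in \<open>auto simp: card_Diff_singleton\<close>)
  then have "card {C. a \<in> C \<and> C \<subseteq> S \<and> card C = p} = card {B. B \<subseteq> S - {a} \<and> card B = p - 1}"
    by (simp add: bij_betw_same_card)
  also have "\<dots> = card (S - {a}) choose (p - 1)" using assms by (intro n_subsets) auto
  also have "card (S - {a}) = card S - 1" using assms by simp
  finally show ?thesis .
qed

section \<open>Generating functions of cycle classes\<close>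

text \<open>For positive parts this is the number of set partitions with block sizes
  \<open>lam\<close>. The number of permutations of cycle type \<open>lam\<close> carries the
  further factor \<open>fact (p - 1)\<close> for each part, which the polynomials
  \<open>cycle_exc_poly (p - 1)\<close> supply at t = 1.\<close>

definition cycle_class_size :: "nat multiset \<Rightarrow> real" where
  "cycle_class_size lam = multinomial (sum_mset lam) lam / (\<Prod>i\<in>set_mset lam. fact (count lam i))"

lemma sum_times_count:
  fixes M :: "nat multiset"
  assumes "finite A" "set_mset M \<subseteq> A"
  shows "(\<Sum>x\<in>A. x * count M x) = sum_mset M"
  using assms(2)
proof (induction M)
  case (add a M)
  have "(\<Sum>x\<in>A. x * count (add_mset a M) x) = (\<Sum>x\<in>A. x * count M x + (if a = x then a else 0))"
    by (intro sum.cong) auto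
  also have "\<dots> = sum_mset (add_mset a M)"
    using add assms(1) by (simp add: sum.distrib)
  finally show ?case .
qed simp

text \<open>Deleting one part \<open>p\<close> removes a factor \<open>fact p\<close> and lowers one
  multiplicity. Once the binomial is expanded, only the weight \<open>p * count lam p\<close>
  depends on \<open>p\<close>.\<close>

lemma cycle_class_size_remove:
  assumes "p \<in># lam" "p \<ge> 1"
  shows "real ((sum_mset lam - 1) choose (p - 1)) * cycle_class_size (lam - {#p#}) =
    real (p * count lam p) * 
      (fact (sum_mset lam - 1) / ((\<Prod>p\<in>#lam. fact p) * (\<Prod>i\<in>set_mset lam. fact (count lam i))))"
proof -
  define \<mu> where "\<mu> = lam - {#p#}"
  have lam: "lam = add_mset p \<mu>" using assms by (simp add: \<mu>_def)
  have sum: "sum_mset lam = p + sum_mset \<mu>" by (simp add: lam)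
  define R :: real where "R = (\<Prod>i\<in>set_mset lam - {p}. fact (count lam i))"
  have lam_prod: "(\<Prod>i\<in>set_mset lam. fact (count lam i)) = fact (count lam p) * R"
    unfolding R_def using assms by (intro prod.remove) auto
  \<comment> \<open>If the last copy of \<open>p\<close> was removed, its factor is
    \<open>fact 0 = 1\<close>, so the product may run over \<open>set_mset lam\<close>.\<close>
  have "(\<Prod>i\<in>set_mset \<mu>. fact (count \<mu> i)) = (\<Prod>i\<in>set_mset lam. fact (count \<mu> i) :: real)"
    by (rule prod.mono_neutral_left) (auto simp: lam not_in_iff)
  also have "\<dots> = fact (count \<mu> p) * (\<Prod>i\<in>set_mset lam - {p}. fact (count \<mu> i))"
    using assms by (intro prod.remove) auto
  also have "(\<Prod>i\<in>set_mset lam - {p}. fact (count \<mu> i)) = R"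
    unfolding R_def by (intro prod.cong) (auto simp: lam)
  finally have \<mu>_prod: "(\<Prod>i\<in>set_mset \<mu>. fact (count \<mu> i)) = fact (count \<mu> p) * R" .
  have cnt: "count lam p = Suc (count \<mu> p)" by (simp add: lam)
  have R: "R \<noteq> 0" by (simp add: R_def)
  have F: "(\<Prod>p\<in>#\<mu>. fact p :: real) \<noteq> 0" by (auto simp: prod_mset_zero_iff)
  obtain q where q: "p = Suc q" using assms(2) by (cases p) auto
  have "real ((sum_mset lam - 1) choose (p - 1)) = fact (q + sum_mset \<mu>) / (fact q * fact (sum_mset \<mu>))"
    unfolding sum q by (subst binomial_fact) auto
  then have "real ((sum_mset lam - 1) choose (p - 1)) * cycle_class_size \<mu> = 
      fact (q + sum_mset \<mu>) / (fact q * ((\<Prod>p\<in>#\<mu>. fact p) * (fact (count \<mu> p) * R)))"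
    by (simp add: cycle_class_size_def multinomial_def \<mu>_prod)
  also have "\<dots> = real (p * count lam p) * 
      (fact (q + sum_mset \<mu>) / ((fact p * (\<Prod>p\<in>#\<mu>. fact p)) * (fact (count lam p) * R)))"
    using R F by (simp add: q cnt[unfolded q] divide_simps) (simp add: algebra_simps)
  finally show ?thesis
    unfolding lam_prod by (simp add: \<mu>_def[symmetric] sum q lam)
qed

lemma sum_mset_pos:
  fixes lam :: "nat multiset"
  assumes "lam \<noteq> {#}" "\<And>p. p \<in># lam \<Longrightarrow> p \<ge> 1"
  shows "sum_mset lam > 0"
proof -
  obtain q where q: "q \<in># lam" using assms(1) by blast
  then have "sum_mset lam = q + sum_mset (lam - {#q#})" by (metis insert_DiffM sum_mset.add_mset)
  with assms(2)[OF q] show ?thesis by simp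
qed

text \<open>Combinatorially, set partitions are sorted by the size of the block of a fixed element.
  In the computation the summands share a constant, and the weights \<open>p * count lam p\<close>
  add up to \<open>sum_mset lam\<close>.\<close>

lemma cycle_class_size_rec:
  assumes "lam \<noteq> {#}" "\<And>p. p \<in># lam \<Longrightarrow> p \<ge> 1"
  shows "cycle_class_size lam =
    (\<Sum>p\<in>set_mset lam. real ((sum_mset lam - 1) choose (p - 1)) * cycle_class_size (lam - {#p#}))"
proof -
  define K where "K = fact (sum_mset lam - 1) / 
    ((\<Prod>p\<in>#lam. fact p) * (\<Prod>i\<in>set_mset lam. fact (count lam i)) :: real)"
  have pos: "sum_mset lam > 0" using assms by (rule sum_mset_pos)
  have "(\<Sum>p\<in>set_mset lam. real ((sum_mset lam - 1) choose (p - 1)) * cycle_class_size (lam - {#p#})) =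
    (\<Sum>p\<in>set_mset lam. real (p * count lam p) * K)"
    using assms(2) by (intro sum.cong refl) (simp only: cycle_class_size_remove K_def)
  also have "\<dots> = real (\<Sum>p\<in>set_mset lam. p * count lam p) * K"
    by (simp add: sum_distrib_right)
  also have "(\<Sum>p\<in>set_mset lam. p * count lam p) = sum_mset lam" by (simp add: sum_times_count)
  also have "real (sum_mset lam) * K = cycle_class_size lam"
    using pos by (simp add: K_def cycle_class_size_def multinomial_def fact_reduce[of "sum_mset lam"])
  finally show ?thesis ..
qed

text \<open>Induction on the number of parts. The factor of \<open>C\<close> completes the product
  for the remaining parts to the same \<open>P\<close> for every \<open>C\<close>, so the scalar
  depends on \<open>C\<close> only through its size. Counting the sets \<open>C\<close> by size then
  gives \<open>cycle_class_size_rec\<close>.\<close>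

lemma sum_cycle_class_on:
  assumes "finite S" "card S = sum_mset lam" "\<And>p. p \<in># lam \<Longrightarrow> p \<ge> 1"
  shows "(\<Sum>\<pi>\<in>cycle_class_on S lam. monom 1 (excedances S \<pi>)) =
    smult (cycle_class_size lam) (\<Prod>p\<in>#lam. cycle_exc_poly (p - 1))"
  using assms
proof (induction "size lam" arbitrary: S lam)
  case 0
  then have "lam = {#}" "S = {}" by auto
  then show ?case
    by (simp add: cycle_class_on_def cycle_type_on_def excedances_def cycle_class_size_def
        multinomial_def monom_0 one_pCons)
next
  case (Suc k)
  then have ne: "lam \<noteq> {#}" by auto
  then have "sum_mset lam > 0" using Suc.prems(3) by (rule sum_mset_pos)
  then have "S \<noteq> {}" using Suc.prems by (metis card.empty less_irrefl)
  then obtain a where a: "a \<in> S" by blast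
  define P where "P = (\<Prod>p\<in>#lam. cycle_exc_poly (p - 1))"
  define T where "T = {C. a \<in> C \<and> C \<subseteq> S \<and> card C \<in># lam}"
  have finT: "finite T" unfolding T_def by (rule finite_subset[of _ "Pow S"]) (use Suc.prems in auto)
  have "(\<Sum>\<pi>\<in>cycle_class_on S lam. monom 1 (excedances S \<pi>)) = 
      (\<Sum>C\<in>T. smult (cycle_class_size (lam - {#card C#})) P)"
    unfolding sum_cycle_class_on_step[OF Suc.prems(1) a] T_def[symmetric]
  proof (rule sum.cong[OF refl])
    fix C assume "C \<in> T"
    then have C: "C \<subseteq> S" "card C \<in># lam" by (auto simp: T_def)
    define \<mu> where "\<mu> = lam - {#card C#}"
    have lam: "lam = add_mset (card C) \<mu>" using C by (simp add: \<mu>_def)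
    have "(\<Sum>\<rho>\<in>cycle_class_on (S - C) \<mu>. monom 1 (excedances (S - C) \<rho>)) =
        smult (cycle_class_size \<mu>) (\<Prod>p\<in>#\<mu>. cycle_exc_poly (p - 1))"
    proof (rule Suc.hyps(1))
      show "card (S - C) = sum_mset \<mu>"
        using Suc.prems C by (simp add: card_Diff_subset finite_subset lam)
    qed (use Suc lam in auto)
    then show "cycle_exc_poly (card C - 1) * 
        (\<Sum>\<rho>\<in>cycle_class_on (S - C) (lam - {#card C#}). monom 1 (excedances (S - C) \<rho>)) =
        smult (cycle_class_size (lam - {#card C#})) P"
      unfolding \<mu>_def[symmetric] P_def by (simp add: lam)
  qed
  also have "\<dots> = (\<Sum>p\<in>set_mset lam. \<Sum>C | C \<in> T \<and> card C = p. smult (cycle_class_size (lam - {#card C#})) P)"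
    by (rule sum.group[symmetric]) (use finT in \<open>auto simp: T_def\<close>)
  also have "\<dots> = (\<Sum>p\<in>set_mset lam. 
      smult (real ((sum_mset lam - 1) choose (p - 1)) * cycle_class_size (lam - {#p#})) P)"
  proof (rule sum.cong[OF refl])
    fix p assume p: "p \<in> set_mset lam"
    have "{C. C \<in> T \<and> card C = p} = {C. a \<in> C \<and> C \<subseteq> S \<and> card C = p}"
      using p by (auto simp: T_def)
    then have "card {C. C \<in> T \<and> card C = p} = (sum_mset lam - 1) choose (p - 1)"
      using card_subsets_containing[OF Suc.prems(1) a] Suc.prems(2,3) p by simp
    then have "(\<Sum>C | C \<in> T \<and> card C = p. smult (cycle_class_size (lam - {#p#})) P) =
       smult (real ((sum_mset lam - 1) choose (p - 1)) * cycle_class_size (lam - {#p#})) P"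
      by (simp add: of_nat_poly mult.commute)
    moreover have "(\<Sum>C | C \<in> T \<and> card C = p. smult (cycle_class_size (lam - {#card C#})) P) =
       (\<Sum>C | C \<in> T \<and> card C = p. smult (cycle_class_size (lam - {#p#})) P)"
      by (rule sum.cong) auto
    ultimately show "(\<Sum>C | C \<in> T \<and> card C = p. smult (cycle_class_size (lam - {#card C#})) P) =
       smult (real ((sum_mset lam - 1) choose (p - 1)) * cycle_class_size (lam - {#p#})) P"
      by simp
  qed
  also have "\<dots> = smult (cycle_class_size lam) P"
    by (simp only: cycle_class_size_rec[OF ne Suc.prems(3)] smult_sum)
  finally show ?case by (simp add: P_def)
qed

section \<open>Gamma positivity\<close>

text \<open>The parameter \<open>d\<close> is twice the center of symmetry; the truncated exponent
  is the intended one for \<open>2 * i \<le> d\<close>.\<close>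

definition gamma_basis :: "nat \<Rightarrow> nat \<Rightarrow> real poly" where
  "gamma_basis d i = monom 1 i * [:1, 1:] ^ (d - 2 * i)"

text \<open>Unlike \<open>gamma_positive\<close>, the cone prescribes the center and not the degree
  and lowest exponent. It therefore contains 0 and is closed under sums, and in products the
  parameters add.\<close>

definition gamma_cone :: "nat \<Rightarrow> real poly set" where
  "gamma_cone d = {\<Sum>i\<le>d div 2. smult (\<gamma> i) (gamma_basis d i) | \<gamma>. \<forall>i. \<gamma> i \<ge> 0}"

lemma gamma_coneE:
  assumes "f \<in> gamma_cone d"
  obtains \<gamma> where "f = (\<Sum>i\<le>d div 2. smult (\<gamma> i) (gamma_basis d i))" "\<And>i. \<gamma> i \<ge> 0"
  using assms unfolding gamma_cone_def by blast

lemma gamma_cone_add: "f \<in> gamma_cone d \<Longrightarrow> g \<in> gamma_cone d \<Longrightarrow> f + g \<in> gamma_cone d"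
proof (elim gamma_coneE)
  fix \<gamma> \<delta> :: "nat \<Rightarrow> real"
  assume "f = (\<Sum>i\<le>d div 2. smult (\<gamma> i) (gamma_basis d i))" "\<And>i. \<gamma> i \<ge> 0"
    "g = (\<Sum>i\<le>d div 2. smult (\<delta> i) (gamma_basis d i))" "\<And>i. \<delta> i \<ge> 0"
  then show "f + g \<in> gamma_cone d"
    unfolding gamma_cone_def
    by (intro CollectI exI[of _ "\<lambda>i. \<gamma> i + \<delta> i"]) (simp add: smult_add_left sum.distrib)
qed

lemma gamma_cone_smult: "f \<in> gamma_cone d \<Longrightarrow> c \<ge> 0 \<Longrightarrow> smult c f \<in> gamma_cone d"
proof (elim gamma_coneE)
  fix \<gamma> :: "nat \<Rightarrow> real"
  assume "f = (\<Sum>i\<le>d div 2. smult (\<gamma> i) (gamma_basis d i))" "\<And>i. \<gamma> i \<ge> 0" "c \<ge> 0"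
  then show "smult c f \<in> gamma_cone d"
    unfolding gamma_cone_def
    by (intro CollectI exI[of _ "\<lambda>i. c * \<gamma> i"]) (simp add: smult_sum_right)
qed

lemma gamma_cone_0: "0 \<in> gamma_cone d"
  unfolding gamma_cone_def by (intro CollectI exI[of _ "\<lambda>i. 0"]) simp

lemma gamma_cone_sum: "(\<And>i. i \<in> I \<Longrightarrow> f i \<in> gamma_cone d) \<Longrightarrow> sum f I \<in> gamma_cone d"
  by (induction I rule: infinite_finite_induct) (auto intro: gamma_cone_0 gamma_cone_add)

lemma gamma_basis_in_cone: 
  assumes "2 * i \<le> d"
  shows "gamma_basis d i \<in> gamma_cone d"
proof -
  have "gamma_basis d i = (\<Sum>j\<le>d div 2. smult (if j = i then 1 else 0) (gamma_basis d j))"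
  proof -
    have "(\<Sum>j\<le>d div 2. smult (if j = i then 1 else 0) (gamma_basis d j)) =
        (\<Sum>j\<le>d div 2. if j = i then gamma_basis d j else 0)"
      by (intro sum.cong) auto
    then show ?thesis using assms by auto
  qed
  then show ?thesis
    unfolding gamma_cone_def by (intro CollectI exI[of _ "\<lambda>j. if j = i then 1 else 0"]) auto
qed

lemma gamma_basis_mult:
  assumes "2 * i \<le> d" "2 * j \<le> e"
  shows "gamma_basis d i * gamma_basis e j = gamma_basis (d + e) (i + j)"
proof -
  have "d + e - 2 * (i + j) = (d - 2 * i) + (e - 2 * j)" using assms by simp
  moreover have "monom 1 (i + j) = monom (1::real) i * monom 1 j" by (simp add: mult_monom)
  ultimately show ?thesis by (simp only: gamma_basis_def power_add mult_ac)
qed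

lemma gamma_cone_mult:
  assumes "f \<in> gamma_cone d" "g \<in> gamma_cone e"
  shows "f * g \<in> gamma_cone (d + e)"
  using assms
proof (elim gamma_coneE)
  fix \<gamma> \<delta> :: "nat \<Rightarrow> real"
  assume *: "f = (\<Sum>i\<le>d div 2. smult (\<gamma> i) (gamma_basis d i))" "\<And>i. \<gamma> i \<ge> 0"
    "g = (\<Sum>i\<le>e div 2. smult (\<delta> i) (gamma_basis e i))" "\<And>i. \<delta> i \<ge> 0"
  have "f * g = (\<Sum>i\<le>d div 2. \<Sum>j\<le>e div 2. 
      smult (\<gamma> i * \<delta> j) (gamma_basis d i * gamma_basis e j))"
    unfolding * sum_product by (simp add: mult.commute)
  also have "\<dots> \<in> gamma_cone (d + e)"
  proof (intro gamma_cone_sum gamma_cone_smult)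
    fix i j assume "i \<in> {..d div 2}" "j \<in> {..e div 2}"
    then show "gamma_basis d i * gamma_basis e j \<in> gamma_cone (d + e)"
      by (subst gamma_basis_mult) (auto intro!: gamma_basis_in_cone)
  qed (use * in simp)
  finally show ?thesis .
qed

lemma one_in_gamma_cone: "1 \<in> gamma_cone 0"
  using gamma_basis_in_cone[of 0 0] by (simp add: gamma_basis_def monom_0 flip: one_pCons)

lemma gamma_cone_prod_mset:
  assumes "\<And>p. p \<in># lam \<Longrightarrow> f p \<in> gamma_cone (d p)"
  shows "(\<Prod>p\<in>#lam. f p) \<in> gamma_cone (\<Sum>p\<in>#lam. d p)"
  using assms by (induction lam) (auto intro: one_in_gamma_cone gamma_cone_mult)

text \<open>With k = d - 2 i and y = 1 + t, the product rule gives t^i y^k (d t + i (1 - t)) + k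
  t^(i+1) (1 - t) y^(k-1). Now d t + i (1 - t) = i y + k t, and k t y + k t (1 - t) = 2 k t.\<close>

lemma cycle_step_gamma_basis:
  assumes "2 * i \<le> d"
  shows "smult (real d) ([:0, 1:] * gamma_basis d i) + [:0, 1:] * [:1, -1:] * pderiv (gamma_basis d i)
    = smult (real i) (gamma_basis (Suc d) i) 
      + smult (real (2 * (d - 2 * i))) (monom 1 (Suc i) * [:1, 1:] ^ (d - 2 * i - 1))"
proof -
  define X Y :: "real poly" where "X = [:0, 1:]" and "Y = [:1, 1:]"
  define A where "A = monom (1::real) i"
  define k where "k = d - 2 * i"
  have Y: "Y = 1 + X" by (simp add: X_def Y_def one_pCons)
  have X1: "[:1, -1:] = 1 - X" by (simp add: X_def one_pCons)
  have XA: "X * pderiv A = of_nat i * A"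
    unfolding X_def A_def pderiv_monom by (cases i) (simp_all add: monom_Suc of_nat_poly smult_monom)
  have "pderiv Y = 1" by (simp add: Y_def pderiv_pCons)
  then have pY: "pderiv (Y ^ k) = of_nat k * Y ^ (k - 1)" by (simp add: pderiv_power of_nat_poly)
  have sm: "smult (real n) q = of_nat n * q" for n q by (simp add: of_nat_poly)
  have d: "d = k + 2 * i" using assms by (simp add: k_def)
  have mS: "monom 1 (Suc i) = X * A" by (simp add: X_def A_def monom_Suc)
  have basis: "gamma_basis d i = A * Y ^ k" "gamma_basis (Suc d) i = A * Y ^ Suc k"
    using assms by (simp_all add: gamma_basis_def A_def Y_def k_def Suc_diff_le)
  have "X * (1 - X) * pderiv (A * Y ^ k) = 
     (1 - X) * (of_nat i * A) * Y ^ k + X * (1 - X) * A * pderiv (Y ^ k)"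
    unfolding pderiv_mult XA[symmetric] by (simp add: algebra_simps)
  moreover have "of_nat d * (X * (A * Y ^ k)) + ((1 - X) * (of_nat i * A) * Y ^ k + X * (1 - X) * A * pderiv (Y ^ k))
    = of_nat i * (A * Y ^ Suc k) + of_nat (2 * k) * (X * A * Y ^ (k - 1))"
  \<comment> \<open>The exponent \<open>k - 1\<close> in the derivative is truncated at
    \<open>k = 0\<close>, where its coefficient vanishes.\<close>
  proof (cases k)
    case 0
    then show ?thesis unfolding d Y by (simp add: algebra_simps)
  next
    case (Suc j)
    show ?thesis unfolding pY unfolding d Suc by (simp add: Y algebra_simps)
  qed
  ultimately show ?thesis
    unfolding sm X1 basis mS k_def[symmetric] X_def[symmetric] Y_def[symmetric] by simp
qed

lemma cycle_step_gamma_basis_in_cone: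
  assumes "2 * i \<le> d"
  shows "smult (real d) ([:0, 1:] * gamma_basis d i) + [:0, 1:] * [:1, -1:] * pderiv (gamma_basis d i)
    \<in> gamma_cone (Suc d)"
proof -
  have "smult (real (2 * (d - 2 * i))) (monom 1 (Suc i) * [:1, 1:] ^ (d - 2 * i - 1)) \<in> gamma_cone (Suc d)"
  \<comment> \<open>For \<open>d = 2 * i\<close> the index \<open>Suc i\<close> would leave the
    range of the cone, but then the coefficient is 0.\<close>
  proof (cases "d = 2 * i")
    case True
    then show ?thesis by (simp add: gamma_cone_0)
  next
    case False
    then have "monom 1 (Suc i) * [:1, 1:] ^ (d - 2 * i - 1) = gamma_basis (Suc d) (Suc i)"
      using assms by (simp add: gamma_basis_def)
    moreover have "gamma_basis (Suc d) (Suc i) \<in> gamma_cone (Suc d)"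
      using assms False by (intro gamma_basis_in_cone) auto
    ultimately show ?thesis by (simp only: gamma_cone_smult of_nat_0_le_iff)
  qed
  moreover have "smult (real i) (gamma_basis (Suc d) i) \<in> gamma_cone (Suc d)"
    using assms by (intro gamma_cone_smult gamma_basis_in_cone) auto
  ultimately show ?thesis unfolding cycle_step_gamma_basis[OF assms] by (intro gamma_cone_add)
qed

lemma cycle_step_in_gamma_cone:
  assumes "f \<in> gamma_cone d"
  shows "smult (real d) ([:0, 1:] * f) + [:0, 1:] * [:1, -1:] * pderiv f \<in> gamma_cone (Suc d)"
  using assms
proof (elim gamma_coneE)
  fix \<gamma> :: "nat \<Rightarrow> real"
  let ?L = "\<lambda>f. smult (real d) ([:0, 1:] * f) + [:0, 1:] * [:1, -1:] * pderiv f"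
  assume f: "f = (\<Sum>i\<le>d div 2. smult (\<gamma> i) (gamma_basis d i))" and nonneg: "\<And>i. \<gamma> i \<ge> 0"
  have L_smult: "?L (smult c g) = smult c (?L g)" for c g
    by (simp only: pderiv_smult mult_smult_left mult_smult_right smult_add_right smult_smult mult.commute)
  have "?L f = (\<Sum>i\<le>d div 2. ?L (smult (\<gamma> i) (gamma_basis d i)))"
    unfolding f pderiv_sum by (simp only: sum.distrib sum_distrib_left smult_sum_right)
  also have "\<dots> = (\<Sum>i\<le>d div 2. smult (\<gamma> i) (?L (gamma_basis d i)))"
    by (simp only: L_smult)
  also have "\<dots> \<in> gamma_cone (Suc d)"
    using nonneg by (intro gamma_cone_sum gamma_cone_smult cycle_step_gamma_basis_in_cone) auto
  finally show ?thesis .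
qed

text \<open>The factor in the recursion is the length of the shorter cycle, which is the cone
  parameter that \<open>cycle_step_in_gamma_cone\<close> asks for. The induction starts with
  2-cycles, whose polynomial is t; a fixed point gives 1, with center 0 instead of 1/2.\<close>

lemma cycle_exc_poly_in_gamma_cone: "cycle_exc_poly (Suc m) \<in> gamma_cone (Suc (Suc m))"
proof (induction m)
  case 0
  have "cycle_exc_poly (Suc 0) = gamma_basis 2 1"
    by (simp add: gamma_basis_def monom_altdef)
  then show ?case using gamma_basis_in_cone[of 1 2] by (simp add: numeral_2_eq_2)
next
  case (Suc m)
  then show ?case unfolding cycle_exc_poly.simps(2)[of "Suc m"] by (rule cycle_step_in_gamma_cone)
qed

section \<open>Coefficients, symmetry and gamma positivity of the elements of the cone\<close>

lemma coeff_gamma_basis: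
  "coeff (gamma_basis d i) j = (if i \<le> j then real ((d - 2 * i) choose (j - i)) else 0)"
proof (cases "j - i \<le> d - 2 * i")
  case True
  then show ?thesis by (auto simp: gamma_basis_def coeff_monom_mult coeff_linear_poly_power)
next
  case False
  then have "degree ([:1, 1::real:] ^ (d - 2 * i)) < j - i"
    using degree_linear_power[of "1::real" "d - 2 * i"] by simp
  then show ?thesis using False by (auto simp: gamma_basis_def coeff_monom_mult coeff_eq_0)
qed

text \<open>Between \<open>i\<close> and \<open>d - i\<close> this is the symmetry of binomial
  coefficients; outside, both coefficients vanish.\<close>

lemma coeff_gamma_basis_reflect:
  assumes "2 * i \<le> d" "j \<le> d"
  shows "coeff (gamma_basis d i) (d - j) = coeff (gamma_basis d i) j"
proof -
  consider "j < i" | "i \<le> j" "j \<le> d - i" | "d - i < j" by linarith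
  then show ?thesis
  proof cases
    case 2
    then have "(d - 2 * i) choose (j - i) = (d - 2 * i) choose (d - 2 * i - (j - i))"
      by (intro binomial_symmetric) auto
    moreover have "d - 2 * i - (j - i) = d - j - i" using 2 by simp
    ultimately show ?thesis using 2 assms by (simp add: coeff_gamma_basis)
  qed (use assms in \<open>auto simp: coeff_gamma_basis\<close>)
qed

text \<open>\<open>gamma_basis d i\<close> has lowest term t^i with coefficient 1, so the least
  index r with a nonzero coefficient is the low degree. The symmetry about d/2 then forces the
  degree d - r.\<close>

lemma gamma_cone_gamma_positive:
  assumes "f \<in> gamma_cone d" "f \<noteq> 0"
  shows "gamma_positive f" "center_of_symmetry f = real d / 2"
proof -
  obtain \<gamma> where f: "f = (\<Sum>i\<le>d div 2. smult (\<gamma> i) (gamma_basis d i))" and nonneg: "\<And>i. \<gamma> i \<ge> 0"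
    using gamma_coneE[OF assms(1)] by blast
  have coeff_f: "coeff f j = (\<Sum>i\<le>d div 2. \<gamma> i * coeff (gamma_basis d i) j)" for j
    by (simp add: f coeff_sum)
  have reflect: "coeff f (d - j) = coeff f j" if "j \<le> d" for j
    unfolding coeff_f using that by (intro sum.cong refl) (auto simp: coeff_gamma_basis_reflect)
  define r where "r = (LEAST i. i \<le> d div 2 \<and> \<gamma> i \<noteq> 0)"
  have "\<exists>i. i \<le> d div 2 \<and> \<gamma> i \<noteq> 0"
  proof (rule ccontr)
    assume "\<nexists>i. i \<le> d div 2 \<and> \<gamma> i \<noteq> 0"
    then have "f = 0" unfolding f by (intro sum.neutral) auto
    with assms(2) show False by contradiction
  qed
  then have "r \<le> d div 2 \<and> \<gamma> r \<noteq> 0" unfolding r_def by (rule LeastI_ex)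
  then have r: "r \<le> d div 2" "\<gamma> r \<noteq> 0" by auto
  have below_r: "\<gamma> i = 0" if "i < r" for i
    using not_less_Least[OF that[unfolded r_def]] that r(1) by auto
  have coeff_below: "coeff f j = 0" if "j < r" for j
    unfolding coeff_f using that below_r by (intro sum.neutral) (auto simp: coeff_gamma_basis)
  have "coeff f r = (\<Sum>i\<le>d div 2. if i = r then \<gamma> r else 0)"
    unfolding coeff_f
  proof (rule sum.cong[OF refl])
    fix i show "\<gamma> i * coeff (gamma_basis d i) r = (if i = r then \<gamma> r else 0)"
      using below_r[of i] by (cases i r rule: linorder_cases) (auto simp: coeff_gamma_basis)
  qed
  then have coeff_r: "coeff f r \<noteq> 0" using r by simp
  have low: "low_degree f = r"
    unfolding low_degree_def using coeff_r coeff_below by (intro Least_equality) (auto simp: not_less[symmetric])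
  have coeff_above: "coeff f j = 0" if "j > d - r" for j
  proof (cases "j \<le> d")
    case True
    then have "coeff f j = coeff f (d - j)" by (simp add: reflect)
    then show ?thesis using that True by (simp add: coeff_below)
  next
    case False
    then show ?thesis unfolding coeff_f by (intro sum.neutral) (auto simp: coeff_gamma_basis)
  qed
  have deg: "degree f = d - r"
  proof (rule antisym)
    show "degree f \<le> d - r" by (rule degree_le) (use coeff_above in auto)
    show "d - r \<le> degree f" by (rule le_degree) (use coeff_r reflect[of r] r in auto)
  qed
  have pal: "palindromic f"
    unfolding palindromic_def
  proof (intro conjI allI impI)
    fix i assume "i \<le> degree f - low_degree f"
    then have "r + i \<le> d" "degree f - i = d - (r + i)" unfolding deg low using r by auto
    then show "coeff f (low_degree f + i) = coeff f (degree f - i)" by (simp add: low reflect)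
  qed (fact assms(2))
  \<comment> \<open>\<open>gamma_positive\<close> counts from the low degree, so the vanishing terms
    below \<open>r\<close> are dropped and the index is shifted by \<open>r\<close>.\<close>
  have "f = (\<Sum>i\<in>{r..d div 2}. smult (\<gamma> i) (gamma_basis d i))"
    unfolding f using below_r by (intro sum.mono_neutral_right) (auto simp: not_le)
  also have "\<dots> = (\<Sum>i\<le>d div 2 - r. smult (\<gamma> (r + i)) (gamma_basis d (r + i)))"
    by (rule sum.reindex_bij_witness[of _ "\<lambda>i. r + i" "\<lambda>i. i - r"]) (use r in auto)
  finally have f': "f = (\<Sum>i\<le>d div 2 - r. smult (\<gamma> (r + i)) (gamma_basis d (r + i)))" .
  have div: "(d - r - r) div 2 = d div 2 - r" by linarith
  have exp: "d - r - r - 2 * i = d - 2 * (r + i)" for i by simp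
  show "gamma_positive f"
    unfolding gamma_positive_def Let_def deg low div exp
    using pal nonneg f' by (intro conjI exI[of _ "\<lambda>i. \<gamma> (r + i)"]) (auto simp: gamma_basis_def)
  show "center_of_symmetry f = real d / 2"
    unfolding center_of_symmetry_def deg low using r(1) by (simp add: of_nat_diff)
qed

section \<open>Assembling the contributions of the parts\<close>

lemma prod_mset_cycle_exc_poly:
  assumes "\<And>p. p \<in># lam \<Longrightarrow> 1 \<le> p \<and> p \<le> k"
  shows "(\<Prod>p\<in>#lam. cycle_exc_poly (p - 1)) =
    (\<Prod>j=2..k. (monom 1 1 * eulerian_poly (j - 1)) ^ count lam j)"
proof -
  have "(\<Prod>p\<in>#lam. cycle_exc_poly (p - 1)) = (\<Prod>p\<in>set_mset lam. cycle_exc_poly (p - 1) ^ count lam p)"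
    by (rule image_prod_mset_multiplicity)
  also have "\<dots> = (\<Prod>p\<in>{1..k}. cycle_exc_poly (p - 1) ^ count lam p)"
    using assms by (intro prod.mono_neutral_left) (auto simp: not_in_iff)
  \<comment> \<open>The part 1 has to go before Eulerian polynomials enter:
    \<open>cycle_exc_poly 0\<close> is 1, whereas t times \<open>eulerian_poly 0\<close> is
    t.\<close>
  also have "\<dots> = (\<Prod>j\<in>{2..k}. cycle_exc_poly (j - 1) ^ count lam j)"
  proof (intro prod.mono_neutral_right ballI)
    fix i assume "i \<in> {1..k} - {2..k}"
    then have "i = 1" by auto
    then show "cycle_exc_poly (i - 1) ^ count lam i = 1" by simp
  qed auto
  also have "\<dots> = (\<Prod>j\<in>{2..k}. (monom 1 1 * eulerian_poly (j - 1)) ^ count lam j)"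
  proof (rule prod.cong[OF refl])
    fix j assume "j \<in> {2..k}"
    then have "j - 1 \<ge> 1" by auto
    then show "cycle_exc_poly (j - 1) ^ count lam j = (monom 1 1 * eulerian_poly (j - 1)) ^ count lam j"
      by (simp only: X_times_eulerian_poly)
  qed
  finally show ?thesis .
qed

lemma sum_mset_parts_ne_1:
  "(\<Sum>p\<in>#lam. if p = 1 then 0 else p) + count lam 1 = sum_mset (lam :: nat multiset)"
  by (induction lam) auto

theorem theorem41:
  fixes n k :: nat and lam :: "nat multiset"
  assumes "n \<ge> 1"
    and "int_partition lam n"
    and "\<forall>p\<in>#lam. p \<le> k"
  shows "ADerExc n lam =
           smult (multinomial n lam / (\<Prod>i=1..k. fact (count lam i)))
             (\<Prod>j=2..k. (monom 1 1 * eulerian_poly (j - 1)) ^ count lam j)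
       \<and> (count lam 1 = 0 \<longrightarrow>
            gamma_positive (ADerExc n lam) \<and>
            center_of_symmetry (ADerExc n lam) = real n / 2)
       \<and> (count lam 1 > 0 \<longrightarrow>
            gamma_positive (ADerExc n lam) \<and>
            center_of_symmetry (ADerExc n lam) = (real n - real (count lam 1)) / 2)"
proof -
  have parts: "p \<ge> 1" if "p \<in># lam" for p using assms(2) that by (simp add: int_partition_def)
  have n: "sum_mset lam = n" using assms(2) by (simp add: int_partition_def)
  define P where "P = (\<Prod>p\<in>#lam. cycle_exc_poly (p - 1))"
  have "ADerExc n lam = (\<Sum>\<pi>\<in>cycle_class_on {1..n} lam. monom 1 (excedances {1..n} \<pi>))"
    by (simp only: ADerExc_def cycle_class_def cycle_class_on_def cycle_type_def cycle_type_on_def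
        exc_def excedances_def)
  then have eq: "ADerExc n lam = smult (cycle_class_size lam) P"
    unfolding P_def using parts n by (subst (asm) sum_cycle_class_on) auto
  have "(\<Prod>i\<in>set_mset lam. fact (count lam i)) = (\<Prod>i=1..k. fact (count lam i) :: real)"
    using parts assms(3) by (intro prod.mono_neutral_left) (auto simp: not_in_iff)
  then have size: "cycle_class_size lam = multinomial n lam / (\<Prod>i=1..k. fact (count lam i))"
    by (simp add: cycle_class_size_def n)
  have size_pos: "cycle_class_size lam > 0"
    unfolding size multinomial_def prod_mset_multiplicity image_prod_mset_multiplicity
    by (intro divide_pos_pos prod_pos) auto
  \<comment> \<open>A fixed point has parameter 0, a longer cycle its length. The total
    \<open>n - count lam 1\<close> is twice the center in both cases of the claim.\<close>
  have "P \<in> gamma_cone (\<Sum>p\<in>#lam. if p = 1 then 0 else p)"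
    unfolding P_def
  proof (rule gamma_cone_prod_mset)
    fix p assume "p \<in># lam"
    then have "p \<ge> 1" by (rule parts)
    then consider "p = 1" | m where "p = Suc (Suc m)" by (cases p; cases "p - 1") auto
    then show "cycle_exc_poly (p - 1) \<in> gamma_cone (if p = 1 then 0 else p)"
    proof cases
      case (2 m)
      then show ?thesis using cycle_exc_poly_in_gamma_cone[of m] by simp
    qed (simp add: one_in_gamma_cone)
  qed
  moreover have deg: "(\<Sum>p\<in>#lam. if p = 1 then 0 else p) = n - count lam 1" and le: "count lam 1 \<le> n"
    using sum_mset_parts_ne_1[of lam] n by linarith+
  ultimately have cone: "ADerExc n lam \<in> gamma_cone (n - count lam 1)"
    unfolding eq using size_pos by (intro gamma_cone_smult) auto
  \<comment> \<open>The cone contains 0, so nonvanishing is shown separately: the value of each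
    factor at t = 1 is a factorial.\<close>
  have "cycle_exc_poly m \<noteq> 0" for m
    using poly_cycle_exc_poly_1[of m] by (metis fact_nonzero poly_0)
  then have "P \<noteq> 0" unfolding P_def by (auto simp: prod_mset_zero_iff)
  then have "ADerExc n lam \<noteq> 0" using size_pos by (simp add: eq)
  note gamma = gamma_cone_gamma_positive[OF cone this]
  have "P = (\<Prod>j=2..k. (monom 1 1 * eulerian_poly (j - 1)) ^ count lam j)"
    unfolding P_def using parts assms(3) by (intro prod_mset_cycle_exc_poly) auto
  then show ?thesis
    using eq gamma le by (simp add: size of_nat_diff)
qed

end
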